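(* Let $X$ be a shift space on a finite alphabet $A$ with a shift-invariant probability measure $\mu$ and a (monoid) morphism $\varphi\colon A^*\to G$ onto a finite group $G$. For every group language $L=\varphi^{-1}(K)$, $K\subseteq G$, the pointwise density $\dot\delta_L(x)$ exists for $\mu$-almost every $x\in X$. Moreover, the density $\delta_\mu(L)$ exists and is given by $$\delta_\mu(L)=\int_X\dot\delta_L\,d\mu.$$
   Context: A shift space on a finite alphabet $A$ is a nonempty closed subset $X\subseteq A^{\mathbb Z}$ invariant under the shift map $S((x_n)_n)=(x_{n+1})_n$, such that every letter of $A$ occurs in some element of $X$. Write $x_{[i,j)}=x_i\cdots x_{j-1}$. The density of $L\subseteq A^*$ under $\mu$ is $\delta_\mu(L)=\lim_{n\to\infty}\frac1n\sum_{i=0}^{n-1}\mu(\{x\in X:x_{[0,i)}\in L\})$ whenever it exists. For $L=\varphi^{-1}(K)$, the pointwise density of $L$ along the orbit of $x\in X$ is $\dot\delta_L(x)=\lim_{n\to\infty}\frac1n\sum_{i=0}^{n-1}1_K(\varphi(x_{[0,i)}))$ whenever it exists, where $1_K$ is the indicator function of $K$. *)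

theory Defs
  imports "HOL-Probability.Probability" "HOL-Algebra.Group"
begin

text \<open>Elements of \<open>A\<^sup>\<int>\<close> are functions \<open>int \<Rightarrow> 'a\<close> with values in \<open>A\<close>; since the index set is all
  of \<open>int\<close>, the extensional product has no junk outside the index set.\<close>

definition full_shift :: "'a set \<Rightarrow> (int \<Rightarrow> 'a) topology" where
  "full_shift A = product_topology (\<lambda>_. discrete_topology A) UNIV"

definition shift :: "(int \<Rightarrow> 'a) \<Rightarrow> (int \<Rightarrow> 'a)" where
  "shift x = (\<lambda>n. x (n + 1))"

definition shift_space :: "'a set \<Rightarrow> (int \<Rightarrow> 'a) set \<Rightarrow> bool" where
  "shift_space A X \<longleftrightarrow> finite A \<and> X \<noteq> {} \<and> closedin (full_shift A) X \<and> shift ` X = X \<and>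
     (\<forall>a\<in>A. \<exists>x\<in>X. \<exists>n. x n = a)"

definition shift_borel :: "'a set \<Rightarrow> (int \<Rightarrow> 'a) set \<Rightarrow> (int \<Rightarrow> 'a) measure" where
  "shift_borel A X = sigma X {U. openin (subtopology (full_shift A) X) U}"

definition shift_invariant_prob :: "'a set \<Rightarrow> (int \<Rightarrow> 'a) set \<Rightarrow> (int \<Rightarrow> 'a) measure \<Rightarrow> bool" where
  "shift_invariant_prob A X \<mu> \<longleftrightarrow> prob_space \<mu> \<and> space \<mu> = X \<and> sets \<mu> = sets (shift_borel A X) \<and>
     (\<forall>B\<in>sets \<mu>. emeasure \<mu> (shift -` B \<inter> X) = emeasure \<mu> B)"

text \<open>The word \<open>x\<^sub>i \<dots> x\<^sub>j\<^sub>-\<^sub>1\<close>; the bound \<open>j\<close> is exclusive, whereas \<open>[i..j]\<close> on integers is inclusive.\<close>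

definition factor :: "(int \<Rightarrow> 'a) \<Rightarrow> int \<Rightarrow> int \<Rightarrow> 'a list" where
  "factor x i j = map x [i..j - 1]"

definition free_monoid :: "'a set \<Rightarrow> 'a list monoid" where
  "free_monoid A = \<lparr>carrier = lists A, mult = (@), one = []\<rparr>"

text \<open>The library's \<open>hom\<close> and \<open>epi\<close> only demand compatibility with multiplication, so
  preservation of the unit is added.\<close>

definition onto_monoid_morphism :: "'a set \<Rightarrow> ('g, 'm) monoid_scheme \<Rightarrow> ('a list \<Rightarrow> 'g) \<Rightarrow> bool" where
  "onto_monoid_morphism A G \<phi> \<longleftrightarrow> \<phi> \<in> epi (free_monoid A) G \<and> \<phi> [] = \<one>\<^bsub>G\<^esub>"

definition group_language :: "'a set \<Rightarrow> ('a list \<Rightarrow> 'g) \<Rightarrow> 'g set \<Rightarrow> 'a list set" where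
  "group_language A \<phi> K = \<phi> -` K \<inter> lists A"

text \<open>A density exists iff its sequence of averages is \<open>convergent\<close>; \<open>lim\<close> is
  meaningful only in that case.\<close>

definition density_averages :: "(int \<Rightarrow> 'a) measure \<Rightarrow> 'a list set \<Rightarrow> nat \<Rightarrow> real" where
  "density_averages \<mu> L n = (1 / real n) * (\<Sum>i<n. measure \<mu> {x \<in> space \<mu>. factor x 0 (int i) \<in> L})"

definition density_of :: "(int \<Rightarrow> 'a) measure \<Rightarrow> 'a list set \<Rightarrow> real" where
  "density_of \<mu> L = lim (density_averages \<mu> L)"

definition pointwise_averages :: "('a list \<Rightarrow> 'g) \<Rightarrow> 'g set \<Rightarrow> (int \<Rightarrow> 'a) \<Rightarrow> nat \<Rightarrow> real" where
  "pointwise_averages \<phi> K x n = (1 / real n) * (\<Sum>i<n. indicator K (\<phi> (factor x 0 (int i))))"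

definition pointwise_density :: "('a list \<Rightarrow> 'g) \<Rightarrow> 'g set \<Rightarrow> (int \<Rightarrow> 'a) \<Rightarrow> real" where
  "pointwise_density \<phi> K x = lim (pointwise_averages \<phi> K x)"

end

theory Submission
  imports Defs
begin

text \<open>
  The skew product \<open>R (x, g) = (S x, g \<cdot> \<phi>(x\<^sub>0))\<close> on \<open>X \<times> G\<close> preserves the product of \<open>\<mu>\<close> with the
  counting measure, because right multiplication permutes \<open>G\<close>. As \<open>R\<^sup>i (x, 1)\<close> has second
  component \<open>\<phi>(x\<^sub>0 \<dots> x\<^sub>i\<^sub>-\<^sub>1)\<close>, the pointwise averages of \<open>L\<close> at \<open>x\<close> are the Birkhoff averages of
  \<open>1\<^sub>K(g)\<close> at \<open>(x, 1)\<close>. They converge almost everywhere by Birkhoff's theorem, each fibre over \<open>G\<close>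
  having positive weight, and dominated convergence yields the formula for the density.

  Birkhoff's theorem for bounded functions is obtained by Garsia's method. With
  \<open>F\<^sub>N = max(0, S\<^sub>1 f, \<dots>, S\<^sub>N f)\<close> one has \<open>F\<^sub>N - F\<^sub>N \<circ> T \<le> f\<close> on \<open>{F\<^sub>N > 0}\<close>, so \<open>f\<close> has
  nonnegative integral there. Applied to \<open>f - b\<close> and \<open>a - f\<close> on the invariant set where
  \<open>liminf < a < b < limsup\<close>, this forces that set to be null.
\<close>

section \<open>Birkhoff sums of a measure-preserving map\<close>

locale measure_preserving = finite_measure M for M :: "'b measure" +
  fixes T :: "'b \<Rightarrow> 'b"
  assumes T_measurable [measurable]: "T \<in> measurable M M"
    and distr_T: "distr M M T = M"
begin

definition birkhoff_sum :: "('b \<Rightarrow> real) \<Rightarrow> nat \<Rightarrow> 'b \<Rightarrow> real" where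
  "birkhoff_sum f n x = (\<Sum>i<n. f ((T ^^ i) x))"

definition birkhoff_average :: "('b \<Rightarrow> real) \<Rightarrow> nat \<Rightarrow> 'b \<Rightarrow> real" where
  "birkhoff_average f n x = (1 / real n) * birkhoff_sum f n x"

text \<open>The maximum of \<open>birkhoff_sum f n x\<close> over \<open>n \<le> N\<close>; the recursive form makes the estimate of
  \<open>F\<^sub>N - F\<^sub>N \<circ> T\<close> immediate.\<close>

fun max_birkhoff_sum :: "('b \<Rightarrow> real) \<Rightarrow> nat \<Rightarrow> 'b \<Rightarrow> real" where
  "max_birkhoff_sum f 0 x = 0"
| "max_birkhoff_sum f (Suc N) x = max 0 (f x + max_birkhoff_sum f N (T x))"

lemma T_space: "x \<in> space M \<Longrightarrow> T x \<in> space M"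
  using measurable_space[OF T_measurable] .

lemma integrable_comp_T:
  fixes f :: "'b \<Rightarrow> real"
  assumes "integrable M f"
  shows "integrable M (\<lambda>x. f (T x))"
  using assms by (intro integrable_distr[OF T_measurable]) (simp add: distr_T)

lemma integral_comp_T:
  fixes f :: "'b \<Rightarrow> real"
  assumes "integrable M f"
  shows "(\<integral>x. f (T x) \<partial>M) = (\<integral>x. f x \<partial>M)"
  using integral_distr[OF T_measurable, of f] borel_measurable_integrable[OF assms]
  by (simp add: distr_T)

lemma birkhoff_sum_Suc: "birkhoff_sum f (Suc n) x = f x + birkhoff_sum f n (T x)"
  unfolding birkhoff_sum_def
  by (subst sum.lessThan_Suc_shift) (simp add: funpow_swap1)

lemma measurable_birkhoff_sum [measurable]:
  assumes [measurable]: "f \<in> borel_measurable M"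
  shows "birkhoff_sum f n \<in> borel_measurable M"
  unfolding birkhoff_sum_def[abs_def] by measurable

lemma measurable_birkhoff_average [measurable]:
  assumes [measurable]: "f \<in> borel_measurable M"
  shows "birkhoff_average f n \<in> borel_measurable M"
  unfolding birkhoff_average_def[abs_def] by measurable

section \<open>Garsia's maximal inequality\<close>

lemma max_birkhoff_sum_nonneg: "0 \<le> max_birkhoff_sum f N x"
  by (cases N) auto

lemma max_birkhoff_sum_mono: "max_birkhoff_sum f N x \<le> max_birkhoff_sum f (Suc N) x"
proof (induction N arbitrary: x)
  case (Suc N)
  show ?case using Suc[of "T x"] by (subst (1 2) max_birkhoff_sum.simps) linarith
qed simp

text \<open>Links the recursion to genuine Birkhoff sums: once some sum of length \<open>n\<close>
  is positive at \<open>x\<close>, so is every \<open>max_birkhoff_sum f N x\<close> with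
  \<open>N\<close> at least \<open>n\<close>.\<close>

lemma birkhoff_sum_le_max: "n \<le> N \<Longrightarrow> birkhoff_sum f n x \<le> max_birkhoff_sum f N x"
proof (induction N arbitrary: n x)
  case 0
  then show ?case by (simp add: birkhoff_sum_def)
next
  case (Suc N)
  show ?case
  proof (cases n)
    case 0
    then show ?thesis by (simp add: birkhoff_sum_def)
  next
    case (Suc m)
    then show ?thesis
      using Suc.IH[of m "T x"] Suc.prems by (simp add: birkhoff_sum_Suc max.coboundedI2)
  qed
qed

lemma integrable_max_birkhoff_sum:
  assumes "integrable M f"
  shows "integrable M (max_birkhoff_sum f N)"
proof (induction N)
  case 0
  then show ?case by (simp add: max_birkhoff_sum.simps(1)[abs_def])
next
  case (Suc N)
  have "integrable M (\<lambda>x. max 0 (f x + max_birkhoff_sum f N (T x)))"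
    by (intro integrable_max Bochner_Integration.integrable_add assms integrable_comp_T[OF Suc]) simp
  then show ?case by (simp add: max_birkhoff_sum.simps(2)[abs_def])
qed

lemma integral_max_positive_nonneg:
  assumes f: "integrable M f"
  shows "0 \<le> (\<integral>x. f x * indicator {x. 0 < max_birkhoff_sum f N x} x \<partial>M)"
proof (cases N)
  case 0
  then show ?thesis by simp
next
  case (Suc N')
  let ?F = "max_birkhoff_sum f N"
  have F: "integrable M ?F" by (rule integrable_max_birkhoff_sum[OF f])
  note [measurable] = borel_measurable_integrable[OF f] borel_measurable_integrable[OF F]
  \<comment> \<open>If \<open>?F x > 0\<close>, the recursion gives
    \<open>?F x = f x + max_birkhoff_sum f N' (T x)\<close>, and monotonicity in the index replaces
    \<open>N'\<close> by \<open>N\<close>. If \<open>?F x = 0\<close>, the left side is at most 0.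
    Integrated, the left side vanishes by invariance of \<open>M\<close>.\<close>
  have "?F x - ?F (T x) \<le> f x * indicator {x. 0 < ?F x} x" for x
    using max_birkhoff_sum_nonneg[of f N "T x"] max_birkhoff_sum_nonneg[of f N x]
      max_birkhoff_sum_mono[of f N' "T x"]
    by (auto simp: Suc indicator_def max_def split: if_splits)
  moreover have "integrable M (\<lambda>x. f x * indicator {x. 0 < ?F x} x)"
    by (rule Bochner_Integration.integrable_bound[OF f]) (auto simp: indicator_def)
  ultimately have "(\<integral>x. ?F x - ?F (T x) \<partial>M) \<le> (\<integral>x. f x * indicator {x. 0 < ?F x} x \<partial>M)"
    using F integrable_comp_T[OF F] by (intro integral_mono) auto
  moreover have "(\<integral>x. ?F x - ?F (T x) \<partial>M) = 0"
    using F integrable_comp_T[OF F] by (simp add: integral_comp_T)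
  ultimately show ?thesis by simp
qed

text \<open>The sets where \<open>max_birkhoff_sum f N\<close> is positive eventually contain each
  point with \<open>f x \<noteq> 0\<close>, and zeros of \<open>f\<close> contribute nothing. So the
  truncated integrals converge to the full one. Exempting zeros of \<open>f\<close> allows functions
  supported on an invariant set.\<close>

lemma maximal_ergodic_inequality:
  assumes f: "integrable M f"
    and pos: "\<And>x. x \<in> space M \<Longrightarrow> f x \<noteq> 0 \<Longrightarrow> \<exists>n. 0 < birkhoff_sum f n x"
  shows "0 \<le> (\<integral>x. f x \<partial>M)"
proof -
  let ?g = "\<lambda>N x. f x * indicator {x. 0 < max_birkhoff_sum f N x} x"
  note [measurable] = borel_measurable_integrable[OF f]
    borel_measurable_integrable[OF integrable_max_birkhoff_sum[OF f]]
  have "(\<lambda>N. ?g N x) \<longlonglongrightarrow> f x" if x: "x \<in> space M" for x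
  proof (cases "f x = 0")
    case False
    then obtain n where "0 < birkhoff_sum f n x" using pos[OF x] by blast
    then have "?g N x = f x" if "n \<le> N" for N
      using birkhoff_sum_le_max[OF that, of f x] by simp
    then show ?thesis by (intro tendsto_eventually) (auto simp: eventually_sequentially)
  qed simp
  then have "(\<lambda>N. \<integral>x. ?g N x \<partial>M) \<longlonglongrightarrow> (\<integral>x. f x \<partial>M)"
    by (intro integral_dominated_convergence[where w = "\<lambda>x. \<bar>f x\<bar>"])
      (use f in \<open>auto simp: indicator_def\<close>)
  then show ?thesis
    by (rule LIMSEQ_le_const) (use integral_max_positive_nonneg[OF f] in blast)
qed

text \<open>The maximal inequality is applied to \<open>f - c\<close> cut off outside
  \<open>E\<close>. Orbits never cross the boundary of an invariant set, so the cutoff factors out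
  of the Birkhoff sums.\<close>

lemma integral_invariant_set_ge:
  assumes f: "integrable M f" and E: "E \<in> sets M"
    and inv: "\<And>x. x \<in> space M \<Longrightarrow> T x \<in> E \<longleftrightarrow> x \<in> E"
    and ge: "\<And>x. x \<in> E \<Longrightarrow> \<exists>n. c * real n < birkhoff_sum f n x"
  shows "c * measure M E \<le> (\<integral>x. f x * indicator E x \<partial>M)"
proof -
  let ?g = "\<lambda>x. f x * indicator E x - c * indicator E x"
  have int: "integrable M (\<lambda>x. f x * indicator E x)" "integrable M (\<lambda>x. c * indicator E x)"
    using integrable_mult_indicator[OF E f] E
    by (simp_all add: mult.commute fmeasurable_eq_sets integrable_indicator_iff less_top[symmetric])
  have sum_g: "birkhoff_sum ?g n x = (birkhoff_sum f n x - c * real n) * indicator E x"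
    if "x \<in> space M" for n x
    using that
  proof (induction n arbitrary: x)
    case 0
    then show ?case by (simp add: birkhoff_sum_def)
  next
    case (Suc n)
    then show ?case using inv[of x] Suc.IH[OF T_space[of x]]
      by (auto simp: birkhoff_sum_Suc indicator_def algebra_simps)
  qed
  have "0 \<le> (\<integral>x. ?g x \<partial>M)"
  proof (rule maximal_ergodic_inequality)
    fix x assume "x \<in> space M" "?g x \<noteq> 0"
    then show "\<exists>n. 0 < birkhoff_sum ?g n x"
      using ge[of x] by (cases "x \<in> E") (auto simp: sum_g)
  qed (use int in simp)
  then show ?thesis using int E by simp
qed

section \<open>Birkhoff's pointwise ergodic theorem for bounded functions\<close>

lemma birkhoff_average_T_diff_tendsto_0:
  assumes bound: "\<And>x. x \<in> space M \<Longrightarrow> \<bar>f x\<bar> \<le> C" and x: "x \<in> space M"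
  shows "(\<lambda>n. birkhoff_average f n (T x) - birkhoff_average f n x) \<longlonglongrightarrow> 0"
proof -
  have space: "(T ^^ n) x \<in> space M" for n
    using x by (induction n) (auto intro: T_space)
  \<comment> \<open>Splitting off the last term here and the first term in
    \<open>birkhoff_sum_Suc\<close> leaves a difference of two values of \<open>f\<close>, at most
    \<open>2 * C\<close> in absolute value, which the factor \<open>1 / real n\<close> sends to
    0.\<close>
  have "birkhoff_sum f (Suc n) x = birkhoff_sum f n x + f ((T ^^ n) x)" for n
    by (simp add: birkhoff_sum_def)
  then have "birkhoff_sum f n (T x) - birkhoff_sum f n x = f ((T ^^ n) x) - f x" for n
    by (simp add: birkhoff_sum_Suc algebra_simps)
  then have "birkhoff_average f n (T x) - birkhoff_average f n x = (1 / real n) * (f ((T ^^ n) x) - f x)" for n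
    unfolding birkhoff_average_def right_diff_distrib[symmetric] by simp
  moreover have "\<bar>f ((T ^^ n) x) - f x\<bar> \<le> 2 * C" for n
    using bound[OF space[of n]] bound[OF x] by linarith
  then have "Bfun (\<lambda>n. f ((T ^^ n) x) - f x) sequentially"
    by (intro BfunI[where K = "2 * C"]) auto
  ultimately show ?thesis
    using bounded_bilinear.Zfun_prod_Bfun[OF bounded_bilinear_mult, of "\<lambda>n. 1 / real n" sequentially]
      lim_1_over_n[where 'a = real] by (simp add: tendsto_Zfun_iff)
qed

text \<open>Adding a null sequence does not change a limsup. With its liminf counterpart, this makes
  the oscillation set below invariant under \<open>T\<close>.\<close>

lemma limsup_birkhoff_average_T:
  assumes bound: "\<And>x. x \<in> space M \<Longrightarrow> \<bar>f x\<bar> \<le> C" and x: "x \<in> space M"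
  shows "limsup (\<lambda>n. ereal (birkhoff_average f n (T x))) = limsup (\<lambda>n. ereal (birkhoff_average f n x))"
proof -
  let ?d = "\<lambda>n. ereal (birkhoff_average f n (T x) - birkhoff_average f n x)"
  have "?d \<longlonglongrightarrow> 0"
    using birkhoff_average_T_diff_tendsto_0[of f C, OF bound x] by (simp add: zero_ereal_def)
  from ereal_limsup_lim_add[OF this, of "\<lambda>n. ereal (birkhoff_average f n x)"]
  show ?thesis by simp
qed

lemma liminf_birkhoff_average_T:
  assumes bound: "\<And>x. x \<in> space M \<Longrightarrow> \<bar>f x\<bar> \<le> C" and x: "x \<in> space M"
  shows "liminf (\<lambda>n. ereal (birkhoff_average f n (T x))) = liminf (\<lambda>n. ereal (birkhoff_average f n x))"
proof -
  let ?d = "\<lambda>n. ereal (birkhoff_average f n (T x) - birkhoff_average f n x)"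
  have "?d \<longlonglongrightarrow> 0"
    using birkhoff_average_T_diff_tendsto_0[of f C, OF bound x] by (simp add: zero_ereal_def)
  from ereal_liminf_lim_add[OF this, of "\<lambda>n. ereal (birkhoff_average f n x)"]
  show ?thesis by simp
qed

lemma birkhoff_oscillation_null:
  fixes a b :: real
  assumes [measurable]: "f \<in> borel_measurable M"
    and bound: "\<And>x. x \<in> space M \<Longrightarrow> \<bar>f x\<bar> \<le> C" and "a < b"
  shows "AE x in M. \<not> (liminf (\<lambda>n. ereal (birkhoff_average f n x)) < a \<and>
    b < limsup (\<lambda>n. ereal (birkhoff_average f n x)))"
proof -
  define E where "E = {x \<in> space M. liminf (\<lambda>n. ereal (birkhoff_average f n x)) < a \<and>
    b < limsup (\<lambda>n. ereal (birkhoff_average f n x))}"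
  have E [measurable]: "E \<in> sets M" unfolding E_def by measurable
  have f: "integrable M f"
    by (rule integrable_const_bound[where B = C]) (use bound in auto)
  have inv: "T x \<in> E \<longleftrightarrow> x \<in> E" if "x \<in> space M" for x
    using that T_space[OF that] limsup_birkhoff_average_T[of f C, OF bound that]
      liminf_birkhoff_average_T[of f C, OF bound that] by (simp add: E_def)
  have "b * measure M E \<le> (\<integral>x. f x * indicator E x \<partial>M)"
  proof (rule integral_invariant_set_ge[OF f E inv])
    fix x assume "x \<in> E"
    then have "\<not> limsup (\<lambda>n. ereal (birkhoff_average f n x)) \<le> b" by (simp add: E_def not_le)
    then have "\<not> eventually (\<lambda>n. ereal (birkhoff_average f n x) \<le> b) sequentially"
      by (rule contrapos_nn) (rule Limsup_bounded)
    \<comment> \<open>The eventual bound is refuted from index 1 on, so the witness is positive and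
      multiplying by \<open>real n\<close> is legitimate.\<close>
    then obtain n where n: "0 < n" "b < birkhoff_average f n x"
      unfolding eventually_sequentially
      by (auto simp: not_le dest!: spec[of _ 1] less_le_trans[OF zero_less_one])
    then show "\<exists>n. b * real n < birkhoff_sum f n x"
      by (intro exI[of _ n]) (simp add: birkhoff_average_def field_simps)
  qed
  moreover have "- a * measure M E \<le> (\<integral>x. - f x * indicator E x \<partial>M)"
  proof (rule integral_invariant_set_ge[OF _ E inv])
    fix x assume "x \<in> E"
    then have "\<not> a \<le> liminf (\<lambda>n. ereal (birkhoff_average f n x))" by (simp add: E_def not_le)
    then have "\<not> eventually (\<lambda>n. a \<le> ereal (birkhoff_average f n x)) sequentially"
      by (rule contrapos_nn) (rule Liminf_bounded)
    then obtain n where n: "0 < n" "birkhoff_average f n x < a"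
      unfolding eventually_sequentially
      by (auto simp: not_le dest!: spec[of _ 1] less_le_trans[OF zero_less_one])
    then show "\<exists>n. - a * real n < birkhoff_sum (\<lambda>x. - f x) n x"
      by (intro exI[of _ n]) (simp add: birkhoff_average_def birkhoff_sum_def sum_negf field_simps)
  qed (use f in simp)
  \<comment> \<open>The integral of \<open>f\<close> over \<open>E\<close> lies above
    \<open>b * measure M E\<close> and below \<open>a * measure M E\<close>.\<close>
  ultimately have "b * measure M E \<le> a * measure M E" by simp
  then have "measure M E = 0"
    using \<open>a < b\<close> measure_nonneg[of M E]
    by (smt (verit) mult_strict_right_mono)
  then have "E \<in> null_sets M" by (simp add: null_sets_def emeasure_eq_measure)
  then show ?thesis by (rule AE_I') (auto simp: E_def)
qed

text \<open>If the liminf were below the limsup, two rationals would fit strictly between them;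
  there are only countably many such pairs, each excluded off a null set. Boundedness makes the
  common extended-real limit finite.\<close>

theorem birkhoff_bounded:
  assumes [measurable]: "f \<in> borel_measurable M"
    and bound: "\<And>x. x \<in> space M \<Longrightarrow> \<bar>f x\<bar> \<le> C"
  shows "AE x in M. convergent (\<lambda>n. birkhoff_average f n x)"
proof -
  let ?li = "\<lambda>x. liminf (\<lambda>n. ereal (birkhoff_average f n x))"
  let ?ls = "\<lambda>x. limsup (\<lambda>n. ereal (birkhoff_average f n x))"
  have "AE x in M. \<forall>a b :: rat. a < b \<longrightarrow> \<not> (?li x < real_of_rat a \<and> real_of_rat b < ?ls x)"
    unfolding AE_all_countable
  proof (intro allI)
    fix a b :: rat
    show "AE x in M. a < b \<longrightarrow> \<not> (?li x < real_of_rat a \<and> real_of_rat b < ?ls x)"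
      using birkhoff_oscillation_null[OF assms(1) bound, of "real_of_rat a" "real_of_rat b"]
      by (cases "a < b") (auto simp: of_rat_less)
  qed
  then show ?thesis
  proof (rule AE_mp, intro AE_I2 impI)
    fix x assume x: "x \<in> space M"
      and osc: "\<forall>a b :: rat. a < b \<longrightarrow> \<not> (?li x < real_of_rat a \<and> real_of_rat b < ?ls x)"
    have le: "?ls x \<le> ?li x"
    proof (rule ccontr)
      assume "\<not> ?ls x \<le> ?li x"
      then obtain a where a: "?li x < real_of_rat a" "real_of_rat a < ?ls x"
        using ereal_dense3[of "?li x" "?ls x"] by (auto simp: not_le)
      then obtain b where b: "real_of_rat a < ereal (real_of_rat b)" "real_of_rat b < ?ls x"
        using ereal_dense3[of "real_of_rat a" "?ls x"] by (auto simp: not_le)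
      show False using osc a b by (auto simp: of_rat_less)
    qed
    have space: "(T ^^ n) x \<in> space M" for n
      using x by (induction n) (auto intro: T_space)
    \<comment> \<open>Covers \<open>n = 0\<close> in the next bound, where the average is 0 because
      \<open>1 / 0 = 0\<close>.\<close>
    have C: "0 \<le> C" using bound[OF x] by linarith
    have avg: "\<bar>birkhoff_average f n x\<bar> \<le> C" for n
    proof (cases "n = 0")
      case False
      have "\<bar>birkhoff_sum f n x\<bar> \<le> (\<Sum>i<n. C)"
        unfolding birkhoff_sum_def
        by (rule order_trans[OF sum_abs]) (intro sum_mono bound space)
      then show ?thesis using False
        by (simp add: birkhoff_average_def abs_mult field_simps)
    qed (use C in \<open>simp add: birkhoff_average_def\<close>)
    have "Liminf sequentially (\<lambda>n. ereal (birkhoff_average f n x)) = ?ls x"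
      by (intro antisym le Liminf_le_Limsup) simp
    moreover have "?ls x \<le> ereal C" "ereal (- C) \<le> ?li x"
      using avg by (auto intro!: Limsup_bounded Liminf_bounded always_eventually simp: abs_le_iff) (smt (verit))
    ultimately obtain l where "?ls x = ereal l" "?li x = ereal l"
      by (cases "?ls x") auto
    then have "(\<lambda>n. ereal (birkhoff_average f n x)) \<longlonglongrightarrow> ereal l"
      by (intro Liminf_eq_Limsup) auto
    then show "convergent (\<lambda>n. birkhoff_average f n x)"
      by (auto simp: convergent_def)
  qed
qed

end

section \<open>Skew products with a finite group\<close>

lemma (in group) bij_betw_mult_right:
  assumes "h \<in> carrier G"
  shows "bij_betw (\<lambda>g. g \<otimes> h) (carrier G) (carrier G)"
  by (rule bij_betw_byWitness[where f' = "\<lambda>g. g \<otimes> inv h"]) (use assms in \<open>auto simp: m_assoc\<close>)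

text \<open>Right multiplication by \<open>c x\<close> maps the fibre over \<open>x\<close> of the
  preimage of \<open>B\<close> bijectively onto the fibre of \<open>B\<close> over
  \<open>T x\<close>, so both have the same cardinality. Integrating over \<open>x\<close> and using
  invariance under \<open>T\<close> gives the claim. The counting measure is not normalised, which
  is why the locale asks only for a finite measure.\<close>

lemma (in measure_preserving) skew_product_measure_preserving:
  fixes G :: "('g, 'm) monoid_scheme"
  assumes "group G" and fin: "finite (carrier G)"
    and c [measurable]: "c \<in> measurable M (count_space (carrier G))"
  shows "measure_preserving (M \<Otimes>\<^sub>M count_space (carrier G)) (\<lambda>(x, g). (T x, g \<otimes>\<^bsub>G\<^esub> c x))"
proof -
  interpret group G by fact
  let ?N = "count_space (carrier G)" and ?R = "\<lambda>(x, g). (T x, g \<otimes>\<^bsub>G\<^esub> c x)"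
  interpret N: finite_measure ?N by (rule finite_measure_count_space[OF fin])
  interpret P: pair_sigma_finite M ?N ..
  \<comment> \<open>The product of two finite counting spaces is again a counting space, so
    multiplication is trivially measurable.\<close>
  have "(\<lambda>p. fst p \<otimes>\<^bsub>G\<^esub> snd p) \<in> measurable (?N \<Otimes>\<^sub>M ?N) ?N"
    using fin by (auto simp: pair_measure_countable countable_finite)
  from measurable_compose[OF _ this, of "\<lambda>(x, g). (g, c x)"]
  have [measurable]: "(\<lambda>(x, g). g \<otimes>\<^bsub>G\<^esub> c x) \<in> measurable (M \<Otimes>\<^sub>M ?N) ?N"
    by (simp add: case_prod_beta)
  have R [measurable]: "?R \<in> measurable (M \<Otimes>\<^sub>M ?N) (M \<Otimes>\<^sub>M ?N)"
    using measurable_Pair[OF measurable_compose[OF measurable_fst T_measurable]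
      \<open>(\<lambda>(x, g). g \<otimes>\<^bsub>G\<^esub> c x) \<in> measurable (M \<Otimes>\<^sub>M ?N) ?N\<close>]
    by (simp add: case_prod_beta')
  have "distr (M \<Otimes>\<^sub>M ?N) (M \<Otimes>\<^sub>M ?N) ?R = M \<Otimes>\<^sub>M ?N"
  proof (rule measure_eqI)
    fix B assume "B \<in> sets (distr (M \<Otimes>\<^sub>M ?N) (M \<Otimes>\<^sub>M ?N) ?R)"
    then have B [measurable]: "B \<in> sets (M \<Otimes>\<^sub>M ?N)" by simp
    have Bsub: "Pair x -` B \<subseteq> carrier G" for x
      using sets.sets_into_space[OF B] by (auto simp: space_pair_measure)
    have fibre: "emeasure ?N (Pair x -` (?R -` B \<inter> space (M \<Otimes>\<^sub>M ?N))) = emeasure ?N (Pair (T x) -` B)"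
      if x: "x \<in> space M" for x
    proof -
      let ?r = "\<lambda>g. g \<otimes>\<^bsub>G\<^esub> c x"
      have bij: "bij_betw ?r (carrier G) (carrier G)"
        using measurable_space[OF c x] by (intro bij_betw_mult_right) simp
      have eq: "Pair x -` (?R -` B \<inter> space (M \<Otimes>\<^sub>M ?N)) = ?r -` (Pair (T x) -` B) \<inter> carrier G"
        using x by (auto simp: space_pair_measure)
      have "Pair (T x) -` B \<subseteq> ?r ` carrier G"
        using Bsub[of "T x"] by (simp add: bij_betw_imp_surj_on[OF bij])
      then have "?r ` (?r -` (Pair (T x) -` B) \<inter> carrier G) = Pair (T x) -` B" by blast
      moreover have "inj_on ?r (?r -` (Pair (T x) -` B) \<inter> carrier G)"
        using bij by (auto simp: bij_betw_def intro: inj_on_subset)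
      ultimately have "card (?r -` (Pair (T x) -` B) \<inter> carrier G) = card (Pair (T x) -` B)"
        by (metis card_image)
      then show ?thesis
        unfolding eq using fin Bsub[of "T x"]
        by (simp add: emeasure_count_space_finite finite_subset)
    qed
    have "emeasure (distr (M \<Otimes>\<^sub>M ?N) (M \<Otimes>\<^sub>M ?N) ?R) B = emeasure (M \<Otimes>\<^sub>M ?N) (?R -` B \<inter> space (M \<Otimes>\<^sub>M ?N))"
      by (rule emeasure_distr[OF R B])
    also have "\<dots> = (\<integral>\<^sup>+x. emeasure ?N (Pair x -` (?R -` B \<inter> space (M \<Otimes>\<^sub>M ?N))) \<partial>M)"
      by (rule N.emeasure_pair_measure_alt) measurable
    also have "\<dots> = (\<integral>\<^sup>+x. emeasure ?N (Pair (T x) -` B) \<partial>M)"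
      by (rule nn_integral_cong[OF fibre])
    also have "\<dots> = (\<integral>\<^sup>+x. emeasure ?N (Pair x -` B) \<partial>(distr M M T))"
      by (rule nn_integral_distr[symmetric]) (use N.measurable_emeasure_Pair[OF B] in auto)
    also have "\<dots> = emeasure (M \<Otimes>\<^sub>M ?N) B"
      by (simp add: distr_T N.emeasure_pair_measure_alt[OF B])
    finally show "emeasure (distr (M \<Otimes>\<^sub>M ?N) (M \<Otimes>\<^sub>M ?N) ?R) B = emeasure (M \<Otimes>\<^sub>M ?N) B" .
  qed simp
  moreover have "finite_measure (M \<Otimes>\<^sub>M ?N)"
    by (rule finite_measure_pair_measure) unfold_locales
  ultimately show ?thesis
    using R by (simp add: measure_preserving_def measure_preserving_axioms_def)
qed

section \<open>Measurability and invariance on shift spaces\<close>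

lemma factor_Suc: "factor x 0 (int (Suc n)) = factor x 0 (int n) @ [x (int n)]"
  by (simp add: factor_def upto_rec2)

context
  fixes A :: "'a set" and X :: "(int \<Rightarrow> 'a) set" and \<mu> :: "(int \<Rightarrow> 'a) measure"
  assumes X: "shift_space A X" and \<mu>: "shift_invariant_prob A X \<mu>"
begin

lemma shift_space_letters: "x \<in> X \<Longrightarrow> x i \<in> A"
  using X closedin_subset[of "full_shift A" X] by (auto simp: shift_space_def full_shift_def PiE_def Pi_def)

lemma open_in_sets: "openin (subtopology (full_shift A) X) U \<Longrightarrow> U \<in> sets \<mu>"
  using \<mu> openin_imp_subset[of "full_shift A" X]
  by (auto simp: shift_invariant_prob_def shift_borel_def intro!: in_measure_of)

text \<open>As \<open>A\<close> is finite, it suffices to treat preimages of single letters; these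
  are cylinders, hence open in \<open>X\<close>.\<close>

lemma coordinate_measurable: "(\<lambda>x. x i) \<in> measurable \<mu> (count_space A)"
proof -
  have "openin (subtopology (full_shift A) X) {x \<in> X. x i = a}" if "a \<in> A" for a
  proof -
    have "continuous_map (subtopology (full_shift A) X) (discrete_topology A) (\<lambda>x. x i)"
      unfolding full_shift_def
      by (intro continuous_map_from_subtopology continuous_map_product_projection) simp
    from openin_continuous_map_preimage[OF this, of "{a}"]
    show ?thesis using that shift_space_letters
      by (auto simp: full_shift_def Int_def PiE_def elim!: back_subst[of "openin _"])
  qed
  moreover have "space \<mu> = X" using \<mu> by (simp add: shift_invariant_prob_def)
  ultimately show ?thesis
    using X shift_space_letters
    by (subst measurable_count_space_eq2)
      (auto simp: shift_space_def Int_def conj_commute vimage_def intro!: open_in_sets)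
qed

text \<open>Each coordinate of \<open>shift x\<close> is a coordinate of \<open>x\<close>, so the
  shift is continuous, and the sigma-algebra is generated by the open sets.\<close>

lemma shift_measurable: "shift \<in> measurable \<mu> \<mu>"
proof -
  have space: "space \<mu> = X" and sets: "sets \<mu> = sets (shift_borel A X)"
    using \<mu> by (simp_all add: shift_invariant_prob_def)
  have shX: "x \<in> X \<Longrightarrow> shift x \<in> X" for x using X by (auto simp: shift_space_def)
  have "continuous_map (full_shift A) (full_shift A) shift"
    unfolding full_shift_def continuous_map_componentwise_UNIV shift_def
    by (intro allI continuous_map_product_projection) simp
  then have cont: "continuous_map (subtopology (full_shift A) X) (subtopology (full_shift A) X) shift"
    using shX by (intro continuous_map_into_subtopology continuous_map_from_subtopology) auto
  have "X \<subseteq> topspace (full_shift A)"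
    using X by (auto simp: shift_space_def dest: closedin_subset)
  then have "shift -` U \<inter> X = {x \<in> topspace (subtopology (full_shift A) X). shift x \<in> U}" for U
    by auto
  then have "shift -` U \<inter> X \<in> sets \<mu>" if "openin (subtopology (full_shift A) X) U" for U
    using openin_continuous_map_preimage[OF cont that] open_in_sets by simp
  then have "shift \<in> measurable \<mu> (shift_borel A X)"
    unfolding shift_borel_def using shX
    by (intro measurable_measure_of) (auto simp: space dest: openin_imp_subset)
  then show ?thesis by (simp cong: measurable_cong_sets add: sets)
qed

lemma shift_measure_preserving: "measure_preserving \<mu> shift"
proof -
  interpret prob_space \<mu> using \<mu> by (simp add: shift_invariant_prob_def)
  note [measurable] = shift_measurable
  have "distr \<mu> \<mu> shift = \<mu>"
    using \<mu> by (intro measure_eqI) (auto simp: shift_invariant_prob_def emeasure_distr)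
  then show ?thesis by unfold_locales auto
qed

end

section \<open>Densities of group languages\<close>

theorem theorem3p12:
  fixes A :: "'a set" and X :: "(int \<Rightarrow> 'a) set" and \<mu> :: "(int \<Rightarrow> 'a) measure"
    and G :: "('g, 'm) monoid_scheme" and \<phi> :: "'a list \<Rightarrow> 'g" and K :: "'g set"
  assumes "shift_space A X"
    and "shift_invariant_prob A X \<mu>"
    and "group G" and "finite (carrier G)"
    and "onto_monoid_morphism A G \<phi>"
    and "K \<subseteq> carrier G"
  shows "(AE x in \<mu>. convergent (pointwise_averages \<phi> K x)) \<and>
    convergent (density_averages \<mu> (group_language A \<phi> K)) \<and>
    integrable \<mu> (pointwise_density \<phi> K) \<and>
    density_of \<mu> (group_language A \<phi> K) = (\<integral>x. pointwise_density \<phi> K x \<partial>\<mu>)"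
proof -
  interpret prob_space \<mu> using assms(2) by (simp add: shift_invariant_prob_def)
  interpret G: group G by fact
  interpret S: measure_preserving \<mu> shift by (rule shift_measure_preserving[OF assms(1,2)])
  have space: "space \<mu> = X" using assms(2) by (simp add: shift_invariant_prob_def)
  have letters: "x i \<in> A" if "x \<in> X" for x i
    using shift_space_letters[OF assms(1,2) that] .
  have factor_A: "factor x i j \<in> lists A" if "x \<in> X" for x i j
    using letters[OF that] by (auto simp: factor_def)
  have \<phi>_one: "\<phi> [] = \<one>\<^bsub>G\<^esub>"
    and \<phi>_carrier: "\<And>w. w \<in> lists A \<Longrightarrow> \<phi> w \<in> carrier G"
    and \<phi>_append: "\<And>v w. v \<in> lists A \<Longrightarrow> w \<in> lists A \<Longrightarrow> \<phi> (v @ w) = \<phi> v \<otimes>\<^bsub>G\<^esub> \<phi> w"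
    using assms(5) by (auto simp: onto_monoid_morphism_def epi_def hom_def free_monoid_def)
  \<comment> \<open>The cocycle of the skew product: the group element read off the letter at
    position 0.\<close>
  define c where "c x = \<phi> [x 0]" for x :: "int \<Rightarrow> 'a"
  let ?N = "count_space (carrier G)"
  let ?R = "\<lambda>(x, g). (shift x, g \<otimes>\<^bsub>G\<^esub> c x)"
  let ?f = "\<lambda>p. indicator K (snd p) :: real"
  have "(\<lambda>a. \<phi> [a]) \<in> measurable (count_space A) ?N"
    using \<phi>_carrier by auto
  from measurable_compose[OF coordinate_measurable[OF assms(1,2), of 0] this]
  have c [measurable]: "c \<in> measurable \<mu> ?N" by (simp add: c_def[abs_def])
  interpret R: measure_preserving "\<mu> \<Otimes>\<^sub>M ?N" ?R
    by (rule S.skew_product_measure_preserving[OF assms(3,4) c])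
  interpret N: finite_measure ?N by (rule finite_measure_count_space[OF assms(4)])
  interpret P: pair_sigma_finite \<mu> ?N ..

  \<comment> \<open>Words grow by appending on the right, which matches right multiplication by
    \<open>c\<close> in \<open>?R\<close>.\<close>
  have orbit: "(?R ^^ i) (x, \<one>\<^bsub>G\<^esub>) = ((shift ^^ i) x, \<phi> (factor x 0 (int i)))" if x: "x \<in> X" for x i
  proof (induction i)
    case 0
    then show ?case by (simp add: factor_def \<phi>_one)
  next
    case (Suc i)
    have "(shift ^^ i) x n = x (n + int i)" for n
      by (induction i arbitrary: n) (auto simp: shift_def algebra_simps)
    then have "c ((shift ^^ i) x) = \<phi> [x (int i)]" by (simp add: c_def)
    then show ?case
      using Suc factor_A[OF x] letters[OF x] by (simp add: factor_Suc \<phi>_append del: of_nat_Suc)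
  qed
  have avg: "pointwise_averages \<phi> K x n = R.birkhoff_average ?f n (x, \<one>\<^bsub>G\<^esub>)" if "x \<in> X" for x n
    by (simp add: pointwise_averages_def R.birkhoff_average_def R.birkhoff_sum_def orbit[OF that])

  have f [measurable]: "?f \<in> borel_measurable (\<mu> \<Otimes>\<^sub>M ?N)"
    by (rule measurable_compose[OF measurable_snd]) simp
  have "AE p in \<mu> \<Otimes>\<^sub>M ?N. convergent (\<lambda>n. R.birkhoff_average ?f n p)"
    by (rule R.birkhoff_bounded[OF f, of 1]) (simp add: indicator_def)
  \<comment> \<open>Only the empty set is null for the counting measure, so for almost every
    \<open>x\<close> convergence holds at every group element, in particular at the unit.\<close>
  from P.AE_pair[OF this]
  have "AE x in \<mu>. convergent (\<lambda>n. R.birkhoff_average ?f n (x, \<one>\<^bsub>G\<^esub>))"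
    by (simp add: AE_count_space) (auto elim!: eventually_mono)
  then have conv: "AE x in \<mu>. convergent (pointwise_averages \<phi> K x)"
    by (rule AE_mp) (auto simp: space fun_eq_iff avg elim!: back_subst[of convergent] intro!: AE_I2)

  have [measurable]: "(\<lambda>x. (x, \<one>\<^bsub>G\<^esub>)) \<in> measurable \<mu> (\<mu> \<Otimes>\<^sub>M ?N)"
    by simp
  have avg_meas [measurable]: "(\<lambda>x. pointwise_averages \<phi> K x n) \<in> borel_measurable \<mu>" for n
    by (subst measurable_cong[OF avg]) (auto simp: space)
  have avg_bound: "norm (pointwise_averages \<phi> K x n) \<le> 1" for x n
  proof -
    have "(\<Sum>i<n. indicator K (\<phi> (factor x 0 (int i))) :: real) \<le> (\<Sum>i<n. 1)"
      by (intro sum_mono) (simp add: indicator_def)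
    moreover have "0 \<le> (\<Sum>i<n. indicator K (\<phi> (factor x 0 (int i))) :: real)"
      by (intro sum_nonneg) simp
    ultimately show ?thesis
      by (cases "n = 0") (simp_all add: pointwise_averages_def field_simps)
  qed
  \<comment> \<open>Where the averages diverge, \<open>lim\<close> takes one fixed value, so the
    density is measurable on the whole space.\<close>
  have density_meas: "pointwise_density \<phi> K \<in> borel_measurable \<mu>"
    unfolding pointwise_density_def[abs_def] by measurable
  have lim: "AE x in \<mu>. pointwise_averages \<phi> K x \<longlonglongrightarrow> pointwise_density \<phi> K x"
    using conv by (simp add: pointwise_density_def convergent_LIMSEQ_iff)
  have dct: "integrable \<mu> (pointwise_density \<phi> K)"
    "(\<lambda>n. \<integral>x. pointwise_averages \<phi> K x n \<partial>\<mu>) \<longlonglongrightarrow> (\<integral>x. pointwise_density \<phi> K x \<partial>\<mu>)"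
    using lim avg_bound density_meas
    by (auto intro!: integrable_dominated_convergence[where w = "\<lambda>_. 1" and s = "\<lambda>n x. pointwise_averages \<phi> K x n"]
        integral_dominated_convergence[where w = "\<lambda>_. 1"])

  \<comment> \<open>Each summand is \<open>?f\<close> evaluated along the orbit of
    \<open>(x, \<one>)\<close>; its measurability allows the integral to be exchanged with the
    finite sum.\<close>
  have visit: "(\<lambda>x. indicator K (\<phi> (factor x 0 (int i))) :: real) \<in> borel_measurable \<mu>" for i
  proof -
    have "(\<lambda>x. ?f ((?R ^^ i) (x, \<one>\<^bsub>G\<^esub>))) \<in> borel_measurable \<mu>"
      by (rule measurable_compose[OF measurable_compose[OF _ measurable_compose_n[OF R.T_measurable]] f])
        measurable
    then show ?thesis
      by (rule measurable_cong[THEN iffD1, rotated]) (simp add: space orbit)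
  qed
  \<comment> \<open>Equality holds for each \<open>n\<close> by linearity of the integral, so
    dominated convergence alone yields the limit. Membership in \<open>lists A\<close> is automatic
    for words read from points of \<open>X\<close>.\<close>
  have "density_averages \<mu> (group_language A \<phi> K) n = (\<integral>x. pointwise_averages \<phi> K x n \<partial>\<mu>)" for n
  proof -
    have "measure \<mu> {x \<in> space \<mu>. factor x 0 (int i) \<in> group_language A \<phi> K} =
        (\<integral>x. indicator K (\<phi> (factor x 0 (int i))) \<partial>\<mu>)" for i
    proof -
      let ?V = "{x \<in> space \<mu>. factor x 0 (int i) \<in> group_language A \<phi> K}"
      have "(\<integral>x. indicator K (\<phi> (factor x 0 (int i))) \<partial>\<mu>) = (\<integral>x. indicator ?V x \<partial>\<mu> :: real)"
        by (intro Bochner_Integration.integral_cong)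
          (auto simp: space indicator_def group_language_def factor_A)
      moreover have "?V \<inter> space \<mu> = ?V" by blast
      ultimately show ?thesis by simp
    qed
    moreover have "integrable \<mu> (\<lambda>x. indicator K (\<phi> (factor x 0 (int i))) :: real)" for i
      by (rule integrable_const_bound[where B = 1]) (auto simp: visit)
    ultimately show ?thesis
      by (simp add: density_averages_def pointwise_averages_def)
  qed
  then have "density_averages \<mu> (group_language A \<phi> K) \<longlonglongrightarrow> (\<integral>x. pointwise_density \<phi> K x \<partial>\<mu>)"
    using dct(2) by presburger
  then show ?thesis
    using conv dct(1) by (auto simp: density_of_def convergent_def limI)
qed

end
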